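(* In the growth curve model $\mathbf{Y}_n = \mathbf{X}\boldsymbol{\Theta}\mathbf{Z}' + \boldsymbol{\mathcal{E}}$, assume that $$\lim_{n\to\infty}\frac{1}{n}(\mathbf{X}'\mathbf{X})=\mathbf{R},$$ where $\mathbf{R}$ is a positive definite matrix. Let $\mathbf{C}$ be a given $s\times m$ real matrix and $\mathbf{D}$ a given $t\times q$ real matrix. Then the two-stage generalized least-squares estimator $$\hat{\boldsymbol{\gamma}}(\mathbf{Y}_n)=\mathbf{C}(\mathbf{X}'\mathbf{X})^{-1}\mathbf{X}'\mathbf{Y}_n\hat{\boldsymbol{\Sigma}}^{-1}(\mathbf{Y}_n)\mathbf{Z}\bigl(\mathbf{Z}'\hat{\boldsymbol{\Sigma}}^{-1}(\mathbf{Y}_n)\mathbf{Z}\bigr)^{-1}\mathbf{D}'$$ is a consistent estimator of $\boldsymbol{\gamma}=\mathbf{C}\boldsymbol{\Theta}\mathbf{D}'$; that is, $\hat{\boldsymbol{\gamma}}(\mathbf{Y}_n)$ converges in probability to $\boldsymbol{\gamma}$ as $n\to\infty$.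
   Context: Fix positive integers $m$ and $p>q$. For each sample size $n>m$: $\mathbf{X}$ is a known (non-random) $n\times m$ matrix of full rank $m$, depending on $n$ (its rows are added one after another as $n$ grows); $\mathbf{Z}$ is a known $p\times q$ matrix of full rank $q$, not depending on $n$; $\boldsymbol{\Theta}$ is an unknown fixed $m\times q$ real matrix; $\boldsymbol{\Sigma}$ is an unknown fixed positive definite $p\times p$ matrix. The $n\times p$ random error matrix $\boldsymbol{\mathcal{E}}=(\boldsymbol{\mathcal{E}}_1,\ldots,\boldsymbol{\mathcal{E}}_n)'$ has a continuous distribution (not assumed normal) with mean $\mathbf{0}$ and $\operatorname{Cov}(\operatorname{vec}(\boldsymbol{\mathcal{E}}'))=\mathbf{I}_n\otimes\boldsymbol{\Sigma}$, and $\boldsymbol{\mathcal{E}}_1,\ldots,\boldsymbol{\mathcal{E}}_n$ are independent and identically distributed random vectors in $\mathbb{R}^p$ whose common distribution does not depend on $n$. A prime denotes transpose, $\operatorname{vec}$ stacks columns, and $\mathbf{P}_X=\mathbf{X}(\mathbf{X}'\mathbf{X})^{-1}\mathbf{X}'$. The first-stage covariance estimator is $$\hat{\boldsymbol{\Sigma}}(\mathbf{Y}_n)=\mathbf{Y}_n'\mathbf{W}\mathbf{Y}_n,\qquad \mathbf{W}=\frac{1}{n-\operatorname{rank}(\mathbf{X})}(\mathbf{I}_n-\mathbf{P}_X),$$ which is taken to be positive definite with probability 1 (so that $\hat{\boldsymbol{\Sigma}}^{-1}(\mathbf{Y}_n)$ is defined almost surely). *)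

theory Defs
  imports "HOL-Probability.Probability"
begin

text \<open>
  Matrices whose dimensions are fixed are elements of \<open>real ^ columns ^ rows\<close>. Matrices with \<open>n\<close> rows,
  where \<open>n\<close> is the varying sample size, are functions from row numbers to rows, of which only the
  rows \<open>0, \<dots>, n - 1\<close> are ever used; \<open>n\<close> is passed explicitly.
\<close>

type_synonym 'k rows = "nat \<Rightarrow> real ^ 'k"

text \<open>\<open>A' B\<close> for matrices \<open>A\<close>, \<open>B\<close> with \<open>n\<close> rows.\<close>

definition tmult :: "nat \<Rightarrow> ('a::finite) rows \<Rightarrow> ('b::finite) rows \<Rightarrow> real ^ 'b ^ 'a"
  where "tmult n A B = (\<chi> j k. \<Sum>i<n. A i $ j * B i $ k)"

text \<open>This is the row rank, which is also how the library's \<^const>\<open>rank\<close> is defined.\<close>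

definition rows_rank :: "nat \<Rightarrow> ('k::finite) rows \<Rightarrow> nat"
  where "rows_rank n A = dim (A ` {..<n})"

text \<open>Entry \<open>(i, j)\<close> of \<open>P\<^sub>X = X (X'X)\<inverse> X'\<close>.\<close>

definition proj_mat :: "nat \<Rightarrow> ('m::finite) rows \<Rightarrow> nat \<Rightarrow> nat \<Rightarrow> real"
  where "proj_mat n X i j = X i \<bullet> (matrix_inv (tmult n X X) *v X j)"

definition W_mat :: "nat \<Rightarrow> ('m::finite) rows \<Rightarrow> nat \<Rightarrow> nat \<Rightarrow> real"
  where "W_mat n X i j =
    1 / (real n - real (rows_rank n X)) * ((if i = j then 1 else 0) - proj_mat n X i j)"

text \<open>\<open>Y' W Y\<close>\<close>

definition Sigma_hat :: "nat \<Rightarrow> ('m::finite) rows \<Rightarrow> ('p::finite) rows \<Rightarrow> real ^ 'p ^ 'p"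
  where "Sigma_hat n X Y = (\<chi> k l. \<Sum>i<n. \<Sum>j<n. Y i $ k * W_mat n X i j * Y j $ l)"

definition gamma_hat ::
  "nat \<Rightarrow> ('m::finite) rows \<Rightarrow> real ^ 'q ^ 'p \<Rightarrow> real ^ 'm ^ 's \<Rightarrow> real ^ 'q ^ 't \<Rightarrow>
    ('p::finite) rows \<Rightarrow> real ^ 't ^ 's"
  where "gamma_hat n X Z C D Y =
    (let S = matrix_inv (Sigma_hat n X Y)
     in C ** matrix_inv (tmult n X X) ** tmult n X Y ** S ** Z
          ** matrix_inv (transpose Z ** S ** Z) ** transpose D)"

definition pos_def :: "real ^ 'k ^ 'k \<Rightarrow> bool"
  where "pos_def A \<longleftrightarrow> transpose A = A \<and> (\<forall>v. v \<noteq> 0 \<longrightarrow> v \<bullet> (A *v v) > 0)"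

definition covariance :: "'a measure \<Rightarrow> ('a \<Rightarrow> real) \<Rightarrow> ('a \<Rightarrow> real) \<Rightarrow> real"
  where "covariance M U V =
    (\<integral>\<omega>. (U \<omega> - (\<integral>\<omega>'. U \<omega>' \<partial>M)) * (V \<omega> - (\<integral>\<omega>'. V \<omega>' \<partial>M)) \<partial>M)"

text \<open>
  Continuity of the joint distribution function of all entries of a random matrix with \<open>n\<close> rows.
  The topology on row sequences is the product topology; the distribution function depends only
  on the first \<open>n\<close> rows of \<open>a\<close>. Every law with a Lebesgue density satisfies this.
\<close>

definition continuous_distribution :: "'a measure \<Rightarrow> nat \<Rightarrow> ('a \<Rightarrow> ('k::finite) rows) \<Rightarrow> bool"
  where "continuous_distribution M n U \<longleftrightarrow>
    continuous_on UNIV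
      (\<lambda>a :: 'k rows. measure M {\<omega> \<in> space M. \<forall>i<n. \<forall>j. U \<omega> i $ j \<le> a i $ j})"

text \<open>
  The measurability requirement keeps \<^const>\<open>measure\<close>, which is \<open>0\<close> on non-measurable sets, from
  making the limit hold spuriously.
\<close>

definition converges_in_probability ::
  "'a measure \<Rightarrow> (nat \<Rightarrow> 'a \<Rightarrow> 'b::metric_space) \<Rightarrow> 'b \<Rightarrow> bool"
  where "converges_in_probability M U c \<longleftrightarrow>
    (\<forall>\<^sub>F n in sequentially. U n \<in> borel_measurable M) \<and>
    (\<forall>\<epsilon>>0. (\<lambda>n. measure M {\<omega> \<in> space M. dist (U n \<omega>) c > \<epsilon>}) \<longlonglongrightarrow> 0)"

end

theory Submission
  imports Defs "HOL-Real_Asymp.Real_Asymp"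
begin

text \<open>
  Put \<open>L = X'X\<close>, \<open>G = L\<inverse> X'\<E>\<close> and \<open>A = \<E>'\<E> / n\<close>. Since \<open>(I - P\<^sub>X) X = 0\<close>, the first-stage estimator equals
  \<open>n / (n - m) (A - G' (L / n) G)\<close>, and the estimator of \<open>\<gamma>\<close> is a fixed function \<open>F\<close> of
  \<open>(A, G, L / n, n / (n - m))\<close> that is continuous at \<open>(\<Sigma>, 0, R, 1)\<close> with value \<open>C \<Theta> D'\<close> there. The weak law of
  large numbers for the array \<open>\<E>\<close> (by truncation, as only second moments of \<open>\<E>\<close> exist) gives \<open>A \<rightarrow> \<Sigma>\<close>;
  the entries of \<open>G\<close> have second moments \<open>(L\<inverse>)\<^sub>a\<^sub>a \<Sigma>\<^sub>b\<^sub>b \<rightarrow> 0\<close>. The continuous mapping theorem concludes.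
\<close>

subsection \<open>Continuity and measurability of matrix operations\<close>

lemma matrix_inv_invertible:
  fixes A :: "'a::semiring_1 ^ 'n ^ 'm"
  assumes "invertible A"
  shows matrix_inv_right: "A ** matrix_inv A = mat 1"
    and matrix_inv_left: "matrix_inv A ** A = mat 1"
  using someI_ex[OF assms[unfolded invertible_def]] unfolding matrix_inv_def by auto

lemma matrix_inv_unique:
  fixes A :: "'a::field ^ 'n ^ 'n"
  assumes "A ** B = mat 1"
  shows "matrix_inv A = B"
proof -
  have "invertible A"
    using assms invertible_right_inverse by blast
  then have "matrix_inv A ** (A ** B) = B"
    by (simp add: matrix_mul_assoc matrix_inv_left)
  then show ?thesis
    by (simp add: assms)
qed

text \<open>Column \<open>c\<close> of the inverse is the solution of a linear system, so Cramer's
  rule applies to it. The point is to have the inverse as an explicit rational function of the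
  entries: both continuity and measurability of inversion are read off from it.\<close>

lemma matrix_inv_cramer:
  fixes A :: "'a::field ^ 'n ^ 'n"
  assumes "det A \<noteq> 0"
  shows "matrix_inv A =
    (\<chi> k c. det (\<chi> i j. if j = k then (if i = c then 1 else 0) else A $ i $ j) / det A)"
proof -
  have "matrix_inv A $ k $ c
      = det (\<chi> i j. if j = k then (if i = c then 1 else 0) else A $ i $ j) / det A" for k c
  proof -
    \<comment> \<open>Multiplying by the unit vector picks out column \<open>c\<close> of the
      inverse, whose right-hand side in the system is that same unit vector.\<close>
    have "A *v (matrix_inv A *v axis c 1) = axis c 1"
      using assms by (simp add: matrix_vector_mul_assoc matrix_inv_right invertible_det_nz)
    then have "matrix_inv A *v axis c 1
        = (\<chi> k. det (\<chi> i j. if j = k then axis c 1 $ i else A $ i $ j) / det A)"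
      by (rule cramer[OF assms, THEN iffD1])
    then have "(matrix_inv A *v axis c 1) $ k
        = det (\<chi> i j. if j = k then axis c 1 $ i else A $ i $ j) / det A"
      by (simp only: vec_lambda_beta)
    moreover have "(matrix_inv A *v axis c 1) $ k = matrix_inv A $ k $ c"
      by (simp add: matrix_vector_mult_def axis_def if_distrib cong: if_cong)
    moreover have "axis c (1::'a) $ i = (if i = c then 1 else 0)" for i
      by (simp add: axis_def)
    ultimately show ?thesis
      by (simp only:)
  qed
  then show ?thesis
    by (simp only: vec_eq_iff vec_lambda_beta) blast
qed

lemma tendsto_matrix_matrix_mult [tendsto_intros]:
  fixes f :: "'a \<Rightarrow> real ^ 'n ^ 'm" and g :: "'a \<Rightarrow> real ^ 'p ^ 'n"
  assumes "(f \<longlongrightarrow> A) F" "(g \<longlongrightarrow> B) F"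
  shows "((\<lambda>x. f x ** g x) \<longlongrightarrow> A ** B) F"
  unfolding matrix_matrix_mult_def by (intro tendsto_intros assms)

lemma tendsto_transpose [tendsto_intros]:
  fixes f :: "'a \<Rightarrow> real ^ 'n ^ 'm"
  assumes "(f \<longlongrightarrow> A) F"
  shows "((\<lambda>x. transpose (f x)) \<longlongrightarrow> transpose A) F"
  unfolding transpose_def by (intro tendsto_intros assms)

lemma tendsto_det [tendsto_intros]:
  fixes f :: "'a \<Rightarrow> real ^ 'n ^ 'n"
  assumes "(f \<longlongrightarrow> A) F"
  shows "((\<lambda>x. det (f x)) \<longlongrightarrow> det A) F"
  unfolding det_def by (intro tendsto_intros assms)

text \<open>The Cramer formula is continuous where the determinant is nonzero. Since
  \<open>det A\<close> is nonzero, so is \<open>det (f x)\<close> eventually, and from then on the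
  formula and \<open>matrix_inv\<close> agree.\<close>

lemma tendsto_matrix_inv [tendsto_intros]:
  fixes f :: "'a \<Rightarrow> real ^ 'n ^ 'n"
  assumes f: "(f \<longlongrightarrow> A) F" and A: "invertible A"
  shows "((\<lambda>x. matrix_inv (f x)) \<longlongrightarrow> matrix_inv A) F"
proof -
  have nz: "det A \<noteq> 0"
    using A invertible_det_nz by blast
  define inv where "inv B =
    (\<chi> k c. det (\<chi> i j. if j = k then (if i = c then 1 else 0) else B $ i $ j) / det B)"
    for B :: "real ^ 'n ^ 'n"
  have "((\<lambda>x. if j = k then y else f x $ i $ j) \<longlongrightarrow> (if j = k then y else A $ i $ j)) F"
    for i j k :: 'n and y
    using f by (auto intro!: tendsto_intros)
  then have "((\<lambda>x. inv (f x)) \<longlongrightarrow> inv A) F"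
    unfolding inv_def by (intro tendsto_intros f nz)
  moreover have "\<forall>\<^sub>F x in F. det (f x) \<noteq> 0"
    using tendsto_det[OF f] nz by (rule tendsto_imp_eventually_ne)
  then have "\<forall>\<^sub>F x in F. inv (f x) = matrix_inv (f x)"
    by eventually_elim (simp add: inv_def matrix_inv_cramer)
  ultimately show ?thesis
    using nz by (simp add: tendsto_cong inv_def matrix_inv_cramer)
qed

section \<open>Borel measurability of vector- and matrix-valued maps\<close>

lemma borel_measurable_vec_iff:
  fixes f :: "'a \<Rightarrow> 'b::euclidean_space ^ 'n"
  shows "f \<in> borel_measurable M \<longleftrightarrow> (\<forall>i. (\<lambda>x. f x $ i) \<in> borel_measurable M)"
proof
  assume f: "f \<in> borel_measurable M"
  have "(\<lambda>x :: 'b ^ 'n. x $ i) \<in> borel_measurable borel" for i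
    by (rule borel_measurable_continuous_onI) (rule continuous_on_component[OF continuous_on_id])
  then show "\<forall>i. (\<lambda>x. f x $ i) \<in> borel_measurable M"
    using measurable_compose[OF f] by blast
next
  \<comment> \<open>The basis vectors of the vector space are the \<open>axis i b\<close>, so inner
    products with them are inner products of single components with \<open>b\<close>; measurability
    of all of these is enough in a Euclidean space.\<close>
  assume "\<forall>i. (\<lambda>x. f x $ i) \<in> borel_measurable M"
  then have "(\<lambda>x. f x $ i \<bullet> b) \<in> borel_measurable M" for i b
    by (intro borel_measurable_inner borel_measurable_const) auto
  then show "f \<in> borel_measurable M"
    by (subst borel_measurable_euclidean_space) (auto simp: Basis_vec_def inner_axis)
qed

lemma borel_measurable_vec_nth [measurable (raw)]:
  fixes f :: "'a \<Rightarrow> 'b::euclidean_space ^ 'n"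
  shows "f \<in> borel_measurable M \<Longrightarrow> (\<lambda>x. f x $ i) \<in> borel_measurable M"
  by (simp add: borel_measurable_vec_iff)

lemma borel_measurable_vec_lambda [measurable (raw)]:
  fixes f :: "'n::finite \<Rightarrow> 'a \<Rightarrow> 'b::euclidean_space"
  assumes "\<And>i. f i \<in> borel_measurable M"
  shows "(\<lambda>x. \<chi> i. f i x) \<in> borel_measurable M"
  using assms by (simp add: borel_measurable_vec_iff)

lemma borel_measurable_matrix_matrix_mult [measurable (raw)]:
  fixes f :: "'a \<Rightarrow> real ^ 'n ^ 'm" and g :: "'a \<Rightarrow> real ^ 'p ^ 'n"
  assumes [measurable]: "f \<in> borel_measurable M" "g \<in> borel_measurable M"
  shows "(\<lambda>x. f x ** g x) \<in> borel_measurable M"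
  unfolding matrix_matrix_mult_def by measurable

lemma borel_measurable_transpose [measurable (raw)]:
  fixes f :: "'a \<Rightarrow> real ^ 'n ^ 'm"
  assumes [measurable]: "f \<in> borel_measurable M"
  shows "(\<lambda>x. transpose (f x)) \<in> borel_measurable M"
  unfolding transpose_def by measurable

lemma borel_measurable_det [measurable (raw)]:
  fixes f :: "'a \<Rightarrow> real ^ 'n ^ 'n"
  assumes [measurable]: "f \<in> borel_measurable M"
  shows "(\<lambda>x. det (f x)) \<in> borel_measurable M"
  unfolding det_def by measurable

text \<open>On singular matrices \<open>matrix_inv\<close> is the choice from an empty predicate, hence constant.\<close>

lemma matrix_inv_singular:
  fixes A :: "real ^ 'n ^ 'n"
  assumes "\<not> invertible A"
  shows "matrix_inv A = (SOME B. False)"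
proof -
  have "(\<lambda>B. A ** B = mat 1 \<and> B ** A = mat 1) = (\<lambda>B. False)"
    using assms by (auto simp: invertible_def)
  then show ?thesis
    unfolding matrix_inv_def by (rule arg_cong)
qed

text \<open>Convergence in probability as defined demands measurability on the whole space,
  including the outcomes with a singular matrix. There the value is constant, and elsewhere it is
  the Cramer formula.\<close>

lemma borel_measurable_matrix_inv [measurable (raw)]:
  fixes f :: "'a \<Rightarrow> real ^ 'n ^ 'n"
  assumes [measurable]: "f \<in> borel_measurable M"
  shows "(\<lambda>x. matrix_inv (f x)) \<in> borel_measurable M"
proof -
  have "(\<lambda>x. matrix_inv (f x)) = (\<lambda>x. if det (f x) = 0 then SOME B. False else
    \<chi> k c. det (\<chi> i j. if j = k then (if i = c then 1 else 0) else f x $ i $ j) / det (f x))"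
    by (auto simp: matrix_inv_cramer matrix_inv_singular invertible_det_nz)
  moreover have "\<dots> \<in> borel_measurable M"
    by measurable
  ultimately show ?thesis by simp
qed

lemma
  fixes f :: "'a \<Rightarrow> 'b::topological_space \<times> 'c::topological_space"
  assumes "f \<in> borel_measurable M"
  shows borel_measurable_fst: "(\<lambda>x. fst (f x)) \<in> borel_measurable M"
    and borel_measurable_snd: "(\<lambda>x. snd (f x)) \<in> borel_measurable M"
  by (auto intro!: measurable_compose[OF assms] borel_measurable_continuous_onI continuous_intros)

subsection \<open>Algebra of the least-squares estimators\<close>

lemma pos_def_invertible:
  assumes "pos_def A"
  shows "invertible A"
proof -
  have "v = 0" if "A *v v = 0" for v
    using assms that by (force simp: pos_def_def)
  then show ?thesis
    using matrix_left_invertible_ker[of A] invertible_left_inverse[of A] by blast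
qed

text \<open>The kernel is trivial. If \<open>v\<close> lies in it, then \<open>w\<close>, the
  inverse of \<open>A\<close> applied to \<open>Z v\<close>, satisfies
  \<open>w . A w = v . Z' w = 0\<close>. Positive definiteness gives \<open>w = 0\<close>, hence
  \<open>Z v = 0\<close>, and full column rank gives \<open>v = 0\<close>.\<close>

lemma invertible_congruence_matrix_inv:
  fixes Z :: "real ^ 'q ^ 'p"
  assumes A: "pos_def A" and Z: "rank Z = CARD('q)"
  shows "invertible (transpose Z ** matrix_inv A ** Z)"
proof -
  have "v = 0" if v: "(transpose Z ** matrix_inv A ** Z) *v v = 0" for v
  proof -
    define w where "w = matrix_inv A *v (Z *v v)"
    have Aw: "A *v w = Z *v v"
      using A by (simp add: w_def matrix_vector_mul_assoc matrix_inv_right pos_def_invertible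
          flip: matrix_mul_assoc) (simp add: matrix_mul_assoc matrix_inv_right pos_def_invertible)
    have "w \<bullet> (A *v w) = v \<bullet> (transpose Z *v w)"
      unfolding Aw transpose_matrix_vector by (metis dot_lmul_matrix inner_commute)
    also have "\<dots> = 0"
      using v by (simp add: w_def matrix_vector_mul_assoc matrix_mul_assoc)
    finally have "w = 0"
      using A unfolding pos_def_def by force
    then have "Z *v v = Z *v 0"
      using Aw by simp
    then show "v = 0"
      using Z full_rank_injective by (metis injD)
  qed
  then show ?thesis
    using matrix_left_invertible_ker[of "transpose Z ** matrix_inv A ** Z"]
      invertible_left_inverse[of "transpose Z ** matrix_inv A ** Z"] by blast
qed

lemma transpose_tmult: "transpose (tmult n A B) = tmult n B A"
  by (simp add: tmult_def transpose_def vec_eq_iff mult.commute)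

lemma tmult_cong:
  assumes "\<And>i. i < n \<Longrightarrow> A i = A' i" "\<And>i. i < n \<Longrightarrow> B i = B' i"
  shows "tmult n A B = tmult n A' B'"
  using assms by (simp add: tmult_def)

lemma tmult_add_left:
  "tmult n (\<lambda>i. A i v* B + E i) W = transpose B ** tmult n A W + tmult n E W"
proof -
  have "(\<Sum>i<n. (\<Sum>l\<in>UNIV. A i $ l * B $ l $ j) * W i $ k)
      = (\<Sum>l\<in>UNIV. B $ l $ j * (\<Sum>i<n. A i $ l * W i $ k))" for j k
    by (simp only: sum_distrib_left sum_distrib_right, subst sum.swap) (simp add: ac_simps)
  then show ?thesis
    by (simp add: tmult_def vec_eq_iff matrix_matrix_mult_def transpose_def vector_matrix_mult_def
        distrib_right sum.distrib)
qed

text \<open>Rewrites the quadratic form in \<open>W\<close> through the cross products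
  \<open>Y'Y\<close>, \<open>X'Y\<close> and \<open>X'X\<close>, whose dimensions do not grow with
  \<open>n\<close>, so that the rest of the argument is algebra of matrices of fixed size.\<close>

lemma Sigma_hat_eq:
  "Sigma_hat n X Y = (1 / (real n - real (rows_rank n X))) *\<^sub>R
    (tmult n Y Y - transpose (tmult n X Y) ** matrix_inv (tmult n X X) ** tmult n X Y)"
proof -
  define V where "V = matrix_inv (tmult n X X)"
  \<comment> \<open>\<open>t k\<close> is column \<open>k\<close> of \<open>X'Y\<close>. By
    bilinearity the double sum over the projection becomes the form of \<open>V\<close> evaluated at
    two such columns.\<close>
  define t where "t k = (\<Sum>i<n. Y i $ k *\<^sub>R X i)" for k
  have t: "tmult n X Y $ a $ k = t k $ a" for a k
    by (simp add: tmult_def t_def mult.commute)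
  have "(\<Sum>i<n. \<Sum>j<n. Y i $ k * proj_mat n X i j * Y j $ l)
      = (transpose (tmult n X Y) ** V ** tmult n X Y) $ k $ l" for k l
  proof -
    have "V *v t l = (\<Sum>j<n. Y j $ l *\<^sub>R (V *v X j))"
      by (simp add: t_def linear_sum[OF matrix_vector_mul_linear] matrix_vector_mult_scaleR)
    then have "(\<Sum>i<n. \<Sum>j<n. Y i $ k * proj_mat n X i j * Y j $ l) = t k \<bullet> (V *v t l)"
      by (simp add: t_def inner_sum_left inner_sum_right proj_mat_def V_def sum_distrib_left
          mult.assoc mult.commute) (rule sum.swap)
    also have "\<dots> = (\<Sum>a\<in>UNIV. \<Sum>b\<in>UNIV. t k $ a * V $ a $ b * t l $ b)"
      by (simp add: inner_vec_def matrix_vector_mult_def sum_distrib_left mult.assoc)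
    also have "\<dots> = (\<Sum>b\<in>UNIV. \<Sum>a\<in>UNIV. t k $ a * V $ a $ b * t l $ b)"
      by (rule sum.swap)
    also have "\<dots> = (transpose (tmult n X Y) ** V ** tmult n X Y) $ k $ l"
      by (simp add: matrix_matrix_mult_def transpose_def t sum_distrib_right)
    finally show ?thesis .
  qed
  moreover have "(\<Sum>i<n. \<Sum>j<n. Y i $ k * (if i = j then 1 else 0) * Y j $ l)
      = tmult n Y Y $ k $ l" for k l
    by (simp add: tmult_def if_distrib if_distribR cong: if_cong)
  ultimately have "(\<Sum>i<n. \<Sum>j<n. Y i $ k * ((if i = j then 1 else 0) - proj_mat n X i j) * Y j $ l)
      = (tmult n Y Y - transpose (tmult n X Y) ** V ** tmult n X Y) $ k $ l" for k l
    by (simp add: algebra_simps sum_subtractf)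
  moreover have "(\<Sum>i<n. \<Sum>j<n. Y i $ k * W_mat n X i j * Y j $ l)
      = 1 / (real n - real (rows_rank n X))
        * (\<Sum>i<n. \<Sum>j<n. Y i $ k * ((if i = j then 1 else 0) - proj_mat n X i j) * Y j $ l)" for k l
    unfolding W_mat_def sum_distrib_left by (intro sum.cong refl) (simp only: ac_simps)
  ultimately show ?thesis
    by (simp add: Sigma_hat_def vec_eq_iff V_def)
qed

lemma transpose_add: "transpose (A + B) = transpose A + transpose B"
  by (simp add: transpose_def vec_eq_iff)

lemma matrix_add_rdistrib: "(A + B) ** C = A ** C + B ** C"
  for A B :: "real ^ 'n ^ 'm"
  by (simp add: matrix_matrix_mult_def vec_eq_iff distrib_right sum.distrib)

text \<open>Read \<open>L = X'X\<close>, \<open>T = X'E\<close>, \<open>V = E'E\<close>. For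
  \<open>Y = X B + E\<close> one has \<open>X'Y = L B + T = L (B + G)\<close>, so the subtracted
  term is \<open>(B + G)' L (B + G)\<close>. Every term containing \<open>B\<close> cancels against
  the expansion of \<open>Y'Y\<close>: this is the identity \<open>(I - P) X = 0\<close> expressed
  by cross products alone.\<close>

lemma residual_cross_product:
  fixes L :: "real ^ 'm ^ 'm" and B T :: "real ^ 'p ^ 'm"
  assumes L: "invertible L" "transpose L = L"
  defines "G \<equiv> matrix_inv L ** T"
  shows "transpose B ** (L ** B + T) + (transpose T ** B + V)
      - transpose (L ** B + T) ** matrix_inv L ** (L ** B + T)
    = V - transpose G ** L ** G"
proof -
  have LG: "L ** G = T"
    by (simp add: G_def matrix_mul_assoc matrix_inv_right L)
  have "matrix_inv L ** (L ** B + T) = B + G"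
    by (simp add: G_def matrix_add_ldistrib matrix_mul_assoc matrix_inv_left L)
  then have "transpose (L ** B + T) ** matrix_inv L ** (L ** B + T)
      = transpose (L ** B + T) ** (B + G)"
    by (simp only: matrix_mul_assoc[symmetric])
  moreover have "transpose (L ** B + T) = transpose (B + G) ** L"
    by (simp add: LG[symmetric] L matrix_transpose_mul flip: matrix_add_ldistrib)
  ultimately have "transpose (L ** B + T) ** matrix_inv L ** (L ** B + T)
      = (transpose B + transpose G) ** L ** (B + G)"
    by (simp add: transpose_add)
  moreover have "transpose T = transpose G ** L"
    using LG by (metis L(2) matrix_transpose_mul)
  ultimately show ?thesis
    using LG by (simp add: matrix_add_ldistrib matrix_add_rdistrib flip: matrix_mul_assoc)
qed

subsection \<open>Convergence in probability\<close>

lemma converges_in_probabilityD: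
  assumes "converges_in_probability M U c" "\<epsilon> > 0"
  shows "(\<lambda>n. measure M {\<omega> \<in> space M. dist (U n \<omega>) c > \<epsilon>}) \<longlonglongrightarrow> 0"
  using assms by (simp add: converges_in_probability_def)

text \<open>Lets the deterministic quantities \<open>X'X / n\<close> and \<open>n / (n - m)\<close>
  enter the joint convergence beside the random ones.\<close>

lemma converges_in_probability_const:
  assumes "x \<longlonglongrightarrow> c"
  shows "converges_in_probability M (\<lambda>n \<omega>. x n) c"
  unfolding converges_in_probability_def
proof (intro conjI allI impI)
  fix \<epsilon> :: real assume "\<epsilon> > 0"
  with assms have "\<forall>\<^sub>F n in sequentially. dist (x n) c < \<epsilon>"
    by (rule tendstoD)
  then have "\<forall>\<^sub>F n in sequentially. measure M {\<omega> \<in> space M. dist (x n) c > \<epsilon>} = 0"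
    by eventually_elim (simp add: not_less less_imp_le)
  then show "(\<lambda>n. measure M {\<omega> \<in> space M. dist (x n) c > \<epsilon>}) \<longlonglongrightarrow> 0"
    by (rule tendsto_eventually)
qed simp

lemma converges_in_probability_cong:
  assumes "\<forall>\<^sub>F n in sequentially. \<forall>\<omega>\<in>space M. U n \<omega> = V n \<omega>"
    and U: "converges_in_probability M U c"
  shows "converges_in_probability M V c"
  unfolding converges_in_probability_def
proof (intro conjI allI impI)
  have "\<forall>\<^sub>F n in sequentially. U n \<in> borel_measurable M"
    using U by (simp add: converges_in_probability_def)
  with assms(1) show "\<forall>\<^sub>F n in sequentially. V n \<in> borel_measurable M"
    by eventually_elim (metis measurable_cong)
next
  fix \<epsilon> :: real assume "\<epsilon> > 0"
  then have "(\<lambda>n. measure M {\<omega> \<in> space M. dist (U n \<omega>) c > \<epsilon>}) \<longlonglongrightarrow> 0"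
    using U by (simp add: converges_in_probability_def)
  moreover from assms(1) have "\<forall>\<^sub>F n in sequentially.
      measure M {\<omega> \<in> space M. dist (U n \<omega>) c > \<epsilon>} = measure M {\<omega> \<in> space M. dist (V n \<omega>) c > \<epsilon>}"
    by eventually_elim (auto intro!: arg_cong[where f = "measure M"])
  ultimately show "(\<lambda>n. measure M {\<omega> \<in> space M. dist (V n \<omega>) c > \<epsilon>}) \<longlonglongrightarrow> 0"
    by (rule Lim_transform_eventually)
qed

text \<open>The product distance is at most the sum of the two distances, so a deviation above
  \<epsilon> forces one component to deviate by more than half of it; a union bound
  finishes.\<close>

lemma (in prob_space) converges_in_probability_Pair:
  fixes U :: "nat \<Rightarrow> 'a \<Rightarrow> 'b::{metric_space, second_countable_topology}"
    and V :: "nat \<Rightarrow> 'a \<Rightarrow> 'c::{metric_space, second_countable_topology}"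
  assumes U: "converges_in_probability M U a" and V: "converges_in_probability M V b"
  shows "converges_in_probability M (\<lambda>n \<omega>. (U n \<omega>, V n \<omega>)) (a, b)"
  unfolding converges_in_probability_def
proof (intro conjI allI impI)
  have Um: "\<forall>\<^sub>F n in sequentially. U n \<in> borel_measurable M"
    and Vm: "\<forall>\<^sub>F n in sequentially. V n \<in> borel_measurable M"
    using U V by (auto simp: converges_in_probability_def)
  then show "\<forall>\<^sub>F n in sequentially. (\<lambda>\<omega>. (U n \<omega>, V n \<omega>)) \<in> borel_measurable M"
    by eventually_elim measurable
  fix \<epsilon> :: real assume "\<epsilon> > 0"
  then have "(\<lambda>n. prob {\<omega> \<in> space M. dist (U n \<omega>) a > \<epsilon> / 2}
      + prob {\<omega> \<in> space M. dist (V n \<omega>) b > \<epsilon> / 2}) \<longlonglongrightarrow> 0"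
    by (intro tendsto_add_zero converges_in_probabilityD[OF U] converges_in_probabilityD[OF V]) auto
  then show "(\<lambda>n. prob {\<omega> \<in> space M. dist (U n \<omega>, V n \<omega>) (a, b) > \<epsilon>}) \<longlonglongrightarrow> 0"
  proof (rule tendsto_sandwich[rotated 2, OF tendsto_const])
    from Um Vm show "\<forall>\<^sub>F n in sequentially. prob {\<omega> \<in> space M. dist (U n \<omega>, V n \<omega>) (a, b) > \<epsilon>}
      \<le> prob {\<omega> \<in> space M. dist (U n \<omega>) a > \<epsilon> / 2} + prob {\<omega> \<in> space M. dist (V n \<omega>) b > \<epsilon> / 2}"
    proof eventually_elim
      case (elim n)
      note [measurable] = elim
      have "dist (U n \<omega>, V n \<omega>) (a, b) \<le> dist (U n \<omega>) a + dist (V n \<omega>) b" for \<omega>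
        unfolding dist_prod_def by (simp add: sqrt_sum_squares_le_sum)
      then have "{\<omega> \<in> space M. dist (U n \<omega>, V n \<omega>) (a, b) > \<epsilon>}
          \<subseteq> {\<omega> \<in> space M. dist (U n \<omega>) a > \<epsilon> / 2} \<union> {\<omega> \<in> space M. dist (V n \<omega>) b > \<epsilon> / 2}"
        by (auto simp: not_less) (smt (verit) field_sum_of_halves)
      then have "prob {\<omega> \<in> space M. dist (U n \<omega>, V n \<omega>) (a, b) > \<epsilon>}
          \<le> prob ({\<omega> \<in> space M. dist (U n \<omega>) a > \<epsilon> / 2} \<union> {\<omega> \<in> space M. dist (V n \<omega>) b > \<epsilon> / 2})"
        by (intro finite_measure_mono) measurable
      also have "\<dots> \<le> prob {\<omega> \<in> space M. dist (U n \<omega>) a > \<epsilon> / 2} + prob {\<omega> \<in> space M. dist (V n \<omega>) b > \<epsilon> / 2}"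
        by (intro measure_Un_le) measurable
      finally show ?case .
    qed
  qed simp
qed

lemma (in prob_space) converges_in_probability_vec:
  fixes U :: "nat \<Rightarrow> 'a \<Rightarrow> 'b::euclidean_space ^ 'n"
  assumes U: "\<And>i. converges_in_probability M (\<lambda>n \<omega>. U n \<omega> $ i) (c $ i)"
  shows "converges_in_probability M U c"
  unfolding converges_in_probability_def
proof (intro conjI allI impI)
  have Um: "\<forall>\<^sub>F n in sequentially. \<forall>i. (\<lambda>\<omega>. U n \<omega> $ i) \<in> borel_measurable M"
    using U by (simp add: converges_in_probability_def eventually_all_finite)
  then show "\<forall>\<^sub>F n in sequentially. U n \<in> borel_measurable M"
    by eventually_elim (simp add: borel_measurable_vec_iff)
  fix \<epsilon> :: real assume \<epsilon>: "\<epsilon> > 0"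
  \<comment> \<open>The Euclidean distance is at most the sum of the component distances, so an
    equal share of \<epsilon> for each component suffices.\<close>
  define \<delta> where "\<delta> = \<epsilon> / CARD('n)"
  have \<delta>: "\<delta> > 0" using \<epsilon> by (simp add: \<delta>_def)
  have "(\<lambda>n. \<Sum>i\<in>UNIV. prob {\<omega> \<in> space M. dist (U n \<omega> $ i) (c $ i) > \<delta>}) \<longlonglongrightarrow> 0"
    by (intro tendsto_null_sum converges_in_probabilityD[OF U] \<delta>)
  then show "(\<lambda>n. prob {\<omega> \<in> space M. dist (U n \<omega>) c > \<epsilon>}) \<longlonglongrightarrow> 0"
  proof (rule tendsto_sandwich[rotated 2, OF tendsto_const])
    from Um show "\<forall>\<^sub>F n in sequentially. prob {\<omega> \<in> space M. dist (U n \<omega>) c > \<epsilon>}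
      \<le> (\<Sum>i\<in>UNIV. prob {\<omega> \<in> space M. dist (U n \<omega> $ i) (c $ i) > \<delta>})"
    proof eventually_elim
      case (elim n)
      then have [measurable]: "(\<lambda>\<omega>. U n \<omega> $ i) \<in> borel_measurable M" for i by blast
      have "dist (U n \<omega>) c \<le> \<epsilon>" if "\<And>i. dist (U n \<omega> $ i) (c $ i) \<le> \<delta>" for \<omega>
      proof -
        have "dist (U n \<omega>) c \<le> (\<Sum>i\<in>UNIV. dist (U n \<omega> $ i) (c $ i))"
          unfolding dist_vec_def by (rule L2_set_le_sum) simp
        also have "\<dots> \<le> (\<Sum>i\<in>(UNIV :: 'n set). \<delta>)"
          by (intro sum_mono that)
        finally show ?thesis by (simp add: \<delta>_def)
      qed
      then have "{\<omega> \<in> space M. dist (U n \<omega>) c > \<epsilon>}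
          \<subseteq> (\<Union>i\<in>UNIV. {\<omega> \<in> space M. dist (U n \<omega> $ i) (c $ i) > \<delta>})"
        by (auto simp: not_less[symmetric])
      then have "prob {\<omega> \<in> space M. dist (U n \<omega>) c > \<epsilon>}
          \<le> prob (\<Union>i\<in>UNIV. {\<omega> \<in> space M. dist (U n \<omega> $ i) (c $ i) > \<delta>})"
        by (intro finite_measure_mono) measurable
      also have "\<dots> \<le> (\<Sum>i\<in>UNIV. prob {\<omega> \<in> space M. dist (U n \<omega> $ i) (c $ i) > \<delta>})"
        by (intro measure_UNION_le) (auto, measurable)
      finally show ?case .
    qed
  qed simp
qed

text \<open>Because the limit is a constant, continuity at that single point controls the deviations
  of the image. Measurability of \<open>f\<close> is a separate assumption, as continuity at one
  point does not give it.\<close>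

lemma (in prob_space) converges_in_probability_continuous_map:
  fixes U :: "nat \<Rightarrow> 'a \<Rightarrow> 'b::{metric_space, second_countable_topology}"
    and f :: "'b \<Rightarrow> 'c::metric_space"
  assumes U: "converges_in_probability M U c"
    and f: "isCont f c" "f \<in> borel_measurable borel"
  shows "converges_in_probability M (\<lambda>n \<omega>. f (U n \<omega>)) (f c)"
  unfolding converges_in_probability_def
proof (intro conjI allI impI)
  have Um: "\<forall>\<^sub>F n in sequentially. U n \<in> borel_measurable M"
    using U by (simp add: converges_in_probability_def)
  then show "\<forall>\<^sub>F n in sequentially. (\<lambda>\<omega>. f (U n \<omega>)) \<in> borel_measurable M"
    by eventually_elim (rule measurable_compose[OF _ f(2)])
  fix \<epsilon> :: real assume "\<epsilon> > 0"
  then obtain \<delta> where \<delta>: "\<delta> > 0" "\<And>x. dist x c < \<delta> \<Longrightarrow> dist (f x) (f c) < \<epsilon>"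
    using f(1) unfolding continuous_at_eps_delta by blast
  \<comment> \<open>Continuity controls points at distance strictly below \<delta>, so a bad outcome
    has distance at least \<delta>. Halving turns this into the strict inequality in the definition
    of convergence.\<close>
  have "(\<lambda>n. prob {\<omega> \<in> space M. dist (U n \<omega>) c > \<delta> / 2}) \<longlonglongrightarrow> 0"
    using \<delta>(1) by (intro converges_in_probabilityD[OF U]) simp
  then show "(\<lambda>n. prob {\<omega> \<in> space M. dist (f (U n \<omega>)) (f c) > \<epsilon>}) \<longlonglongrightarrow> 0"
  proof (rule tendsto_sandwich[rotated 2, OF tendsto_const])
    from Um show "\<forall>\<^sub>F n in sequentially. prob {\<omega> \<in> space M. dist (f (U n \<omega>)) (f c) > \<epsilon>}
      \<le> prob {\<omega> \<in> space M. dist (U n \<omega>) c > \<delta> / 2}"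
    proof eventually_elim
      case (elim n)
      note [measurable] = elim
      have "dist (U n \<omega>) c > \<delta> / 2" if "dist (f (U n \<omega>)) (f c) > \<epsilon>" for \<omega>
        using \<delta>(1) \<delta>(2)[of "U n \<omega>"] that by (smt (verit) field_sum_of_halves)
      then show ?case
        by (intro finite_measure_mono) (auto, measurable)
    qed
  qed simp
qed

text \<open>Chebyshev's inequality. The premises are only eventual because the moments of the errors
  are controlled only for \<open>n > m\<close>.\<close>

lemma (in prob_space) converges_in_probability_second_moment:
  fixes U :: "nat \<Rightarrow> 'a \<Rightarrow> real"
  assumes "\<forall>\<^sub>F n in sequentially. U n \<in> borel_measurable M"
    and "\<forall>\<^sub>F n in sequentially. integrable M (\<lambda>\<omega>. (U n \<omega>)\<^sup>2)"
    and "(\<lambda>n. expectation (\<lambda>\<omega>. (U n \<omega>)\<^sup>2)) \<longlonglongrightarrow> 0"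
  shows "converges_in_probability M U 0"
  unfolding converges_in_probability_def
proof (intro conjI allI impI)
  fix \<epsilon> :: real assume \<epsilon>: "\<epsilon> > 0"
  have "(\<lambda>n. expectation (\<lambda>\<omega>. (U n \<omega>)\<^sup>2) / \<epsilon>\<^sup>2) \<longlonglongrightarrow> 0"
    by (intro tendsto_divide_zero assms(3))
  then show "(\<lambda>n. prob {\<omega> \<in> space M. dist (U n \<omega>) 0 > \<epsilon>}) \<longlonglongrightarrow> 0"
  proof (rule tendsto_sandwich[rotated 2, OF tendsto_const])
    from assms(1,2) show "\<forall>\<^sub>F n in sequentially. prob {\<omega> \<in> space M. dist (U n \<omega>) 0 > \<epsilon>}
      \<le> expectation (\<lambda>\<omega>. (U n \<omega>)\<^sup>2) / \<epsilon>\<^sup>2"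
    proof eventually_elim
      case (elim n)
      note [measurable] = elim(1)
      have "prob {\<omega> \<in> space M. dist (U n \<omega>) 0 > \<epsilon>} \<le> prob {\<omega> \<in> space M. \<bar>U n \<omega>\<bar> \<ge> \<epsilon>}"
        by (intro finite_measure_mono) auto
      also have "\<dots> \<le> expectation (\<lambda>\<omega>. (U n \<omega>)\<^sup>2) / \<epsilon>\<^sup>2"
        by (rule second_moment_method[OF elim \<epsilon>])
      finally show ?case .
    qed
  qed simp
qed (rule assms(1))

section \<open>Second moments of uncorrelated sums and the weak law of large numbers\<close>

lemma integrable_mult_of_squares:
  fixes f g :: "'a \<Rightarrow> real"
  assumes [measurable]: "f \<in> borel_measurable M" "g \<in> borel_measurable M"
    and "integrable M (\<lambda>x. (f x)\<^sup>2)" "integrable M (\<lambda>x. (g x)\<^sup>2)"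
  shows "integrable M (\<lambda>x. f x * g x)"
proof (rule Bochner_Integration.integrable_bound)
  show "integrable M (\<lambda>x. (f x)\<^sup>2 + (g x)\<^sup>2)"
    using assms by simp
  have "\<bar>f x * g x\<bar> \<le> (f x)\<^sup>2 + (g x)\<^sup>2" for x
    using sum_squares_bound[of "f x" "g x"] sum_squares_bound[of "f x" "- g x"]
      zero_le_power2[of "f x"] zero_le_power2[of "g x"] by (auto simp: abs_le_iff)
  then show "AE x in M. norm (f x * g x) \<le> norm ((f x)\<^sup>2 + (g x)\<^sup>2)"
    by auto
qed measurable

text \<open>Expanding the square leaves only the diagonal terms. It is applied to the centred
  truncated summands of the weak law and to the weighted errors that make up the entries of
  \<open>G\<close>.\<close>

lemma (in prob_space)
  fixes X :: "'i \<Rightarrow> 'a \<Rightarrow> real"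
  assumes "finite I"
    and m [measurable]: "\<And>i. i \<in> I \<Longrightarrow> X i \<in> borel_measurable M"
    and sq: "\<And>i. i \<in> I \<Longrightarrow> integrable M (\<lambda>\<omega>. (X i \<omega>)\<^sup>2)"
    and uncorr: "\<And>i j. i \<in> I \<Longrightarrow> j \<in> I \<Longrightarrow> i \<noteq> j \<Longrightarrow> expectation (\<lambda>\<omega>. X i \<omega> * X j \<omega>) = 0"
  shows integrable_square_sum: "integrable M (\<lambda>\<omega>. (\<Sum>i\<in>I. X i \<omega>)\<^sup>2)"
    and expectation_square_sum_uncorrelated:
      "expectation (\<lambda>\<omega>. (\<Sum>i\<in>I. X i \<omega>)\<^sup>2) = (\<Sum>i\<in>I. expectation (\<lambda>\<omega>. (X i \<omega>)\<^sup>2))"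
proof -
  have eq: "(\<Sum>i\<in>I. X i \<omega>)\<^sup>2 = (\<Sum>i\<in>I. \<Sum>j\<in>I. X i \<omega> * X j \<omega>)" for \<omega>
    by (simp add: power2_eq_square sum_product)
  have int: "integrable M (\<lambda>\<omega>. X i \<omega> * X j \<omega>)" if "i \<in> I" "j \<in> I" for i j
    using that by (intro integrable_mult_of_squares m sq)
  then show "integrable M (\<lambda>\<omega>. (\<Sum>i\<in>I. X i \<omega>)\<^sup>2)"
    unfolding eq by (intro Bochner_Integration.integrable_sum) auto
  have "expectation (\<lambda>\<omega>. (\<Sum>i\<in>I. X i \<omega>)\<^sup>2) = (\<Sum>i\<in>I. \<Sum>j\<in>I. expectation (\<lambda>\<omega>. X i \<omega> * X j \<omega>))"
    unfolding eq using int by (simp add: Bochner_Integration.integral_sum)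
  also have "\<dots> = (\<Sum>i\<in>I. \<Sum>j\<in>I. if i = j then expectation (\<lambda>\<omega>. (X i \<omega>)\<^sup>2) else 0)"
    by (intro sum.cong refl) (auto simp: uncorr power2_eq_square)
  also have "\<dots> = (\<Sum>i\<in>I. expectation (\<lambda>\<omega>. (X i \<omega>)\<^sup>2))"
    using assms(1) by simp
  finally show "expectation (\<lambda>\<omega>. (\<Sum>i\<in>I. X i \<omega>)\<^sup>2) = (\<Sum>i\<in>I. expectation (\<lambda>\<omega>. (X i \<omega>)\<^sup>2))" .
qed


text \<open>
  In the weak law \<open>g\<close> is the truncated integrand, treated by Chebyshev's inequality, and \<open>h\<close> the small
  remainder, treated by Markov's inequality.
\<close>

lemma (in prob_space) sample_mean_deviation:
  fixes E :: "nat \<Rightarrow> 'a \<Rightarrow> 'b" and g h :: "'b \<Rightarrow> real"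
  assumes n: "n > 0" and \<epsilon>: "\<epsilon> > 0"
    and indep: "indep_vars (\<lambda>_. N) E {..<n}"
    and distr: "\<And>i. i < n \<Longrightarrow> distr M N (E i) = \<mu>"
    and gm: "g \<in> borel_measurable N" and gK: "\<And>x. \<bar>g x\<bar> \<le> K"
    and hm: "h \<in> borel_measurable N" and hi: "integrable \<mu> h"
  shows "prob {\<omega> \<in> space M. dist ((\<Sum>i<n. g (E i \<omega>) + h (E i \<omega>)) / n) (\<integral>x. g x + h x \<partial>\<mu>) > \<epsilon>}
    \<le> 16 * K\<^sup>2 / (n * \<epsilon>\<^sup>2) + 4 * (\<integral>x. \<bar>h x\<bar> \<partial>\<mu>) / \<epsilon>"
proof -
  have Em: "E i \<in> measurable M N" if "i < n" for i
    using indep that by (auto simp: indep_vars_def)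
  \<comment> \<open>As \<open>n > 0\<close>, there is a row 0 whose law is \<mu>.\<close>
  interpret \<mu>: prob_space \<mu>
    using distr[OF n] prob_space_distr[OF Em[OF n]] by simp
  have sets_\<mu> [measurable_cong]: "sets \<mu> = sets N"
    using distr[OF n] by auto
  have gi: "integrable \<mu> g"
    using gK gm by (intro \<mu>.integrable_const_bound[where B = K]) (auto simp: measurable_cong_sets[OF sets_\<mu> refl])
  have int_E: "expectation (\<lambda>\<omega>. f (E i \<omega>)) = (\<integral>x. f x \<partial>\<mu>)"
    if "i < n" "f \<in> borel_measurable N" for f :: "'b \<Rightarrow> real" and i
    using that by (subst distr[OF that(1), symmetric], subst integral_distr) (auto simp: Em)
  have integrable_E: "integrable M (\<lambda>\<omega>. f (E i \<omega>))"
    if "i < n" "integrable \<mu> f" for f :: "'b \<Rightarrow> real" and i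
    using that(2) unfolding distr[OF that(1), symmetric] by (rule integrable_distr[OF Em[OF that(1)]])
  define a where "a = (\<integral>x. g x \<partial>\<mu>)"
  define b where "b = (\<integral>x. h x \<partial>\<mu>)"
  define \<delta> where "\<delta> = (\<integral>x. \<bar>h x\<bar> \<partial>\<mu>)"
  have aK: "\<bar>a\<bar> \<le> K"
  proof -
    have "\<bar>a\<bar> \<le> (\<integral>x. \<bar>g x\<bar> \<partial>\<mu>)"
      unfolding a_def by (rule integral_abs_bound)
    also have "\<dots> \<le> (\<integral>x. K \<partial>\<mu>)"
      using gi gK by (intro integral_mono) auto
    finally show ?thesis by (simp add: \<mu>.prob_space)
  qed
  \<comment> \<open>The centred truncated summands: bounded by \<open>2 * K\<close>, with mean zero,
    and uncorrelated by independence.\<close>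
  define X where "X i \<omega> = g (E i \<omega>) - a" for i \<omega>
  have Xm [measurable]: "X i \<in> borel_measurable M" if "i \<in> {..<n}" for i
    unfolding X_def using that by (auto intro!: borel_measurable_diff measurable_compose[OF Em gm])
  have XK: "\<bar>X i \<omega>\<bar> \<le> 2 * K" for i \<omega>
    using gK[of "E i \<omega>"] aK unfolding X_def by linarith
  have X2: "(X i \<omega>)\<^sup>2 \<le> 4 * K\<^sup>2" for i \<omega>
    using power_mono[OF XK[of i \<omega>], of 2] by (simp add: power_mult_distrib)
  have Xi: "integrable M (X i)" and X0: "expectation (X i) = 0" if "i < n" for i
    using integrable_E[OF that gi] int_E[OF that gm] unfolding X_def
    by (simp_all add: a_def prob_space)
  have Xsq: "integrable M (\<lambda>\<omega>. (X i \<omega>)\<^sup>2)" if "i \<in> {..<n}" for i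
    using that Xm[OF that] X2 by (intro integrable_const_bound[where B = "4 * K\<^sup>2"]) auto
  have uncorr: "expectation (\<lambda>\<omega>. X i \<omega> * X j \<omega>) = 0" if "i \<in> {..<n}" "j \<in> {..<n}" "i \<noteq> j" for i j
  proof -
    have "indep_vars (\<lambda>_. borel) X {i, j}"
      unfolding X_def using that indep
      by (intro indep_vars_compose2[where X = E and Y = "\<lambda>_ x. g x - a" and M' = "\<lambda>_. N"])
        (auto intro: indep_vars_subset borel_measurable_diff gm)
    then have "expectation (\<lambda>\<omega>. \<Prod>k\<in>{i, j}. X k \<omega>) = (\<Prod>k\<in>{i, j}. expectation (X k))"
      using that by (intro indep_vars_lebesgue_integral) (auto intro: Xi)
    then show ?thesis using that X0 by simp
  qed
  define U where "U \<omega> = (\<Sum>i<n. X i \<omega>)" for \<omega>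
  \<comment> \<open>A nonnegative majorant of the centred remainder: \<open>h\<close> has mean
    \<open>b\<close> with absolute value at most \<delta>, and each summand of \<open>V\<close> has
    expectation \<open>2 *\<close>\<delta>.\<close>
  define V where "V \<omega> = (\<Sum>i<n. \<bar>h (E i \<omega>)\<bar> + \<delta>)" for \<omega>
  have Um [measurable]: "U \<in> borel_measurable M"
    unfolding U_def by measurable
  have Vi: "integrable M V"
    unfolding V_def using integrable_E[OF _ integrable_abs[OF hi]]
    by (intro Bochner_Integration.integrable_sum) auto
  have Vm [measurable]: "V \<in> borel_measurable M"
    using Vi by auto
  have U2: "expectation (\<lambda>\<omega>. (U \<omega>)\<^sup>2) \<le> n * (4 * K\<^sup>2)"
  proof -
    have "expectation (\<lambda>\<omega>. (U \<omega>)\<^sup>2) = (\<Sum>i<n. expectation (\<lambda>\<omega>. (X i \<omega>)\<^sup>2))"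
      unfolding U_def by (intro expectation_square_sum_uncorrelated Xm Xsq uncorr) auto
    also have "\<dots> \<le> (\<Sum>i<n. expectation (\<lambda>\<omega>. 4 * K\<^sup>2))"
      using Xsq X2 by (intro sum_mono integral_mono) auto
    finally show ?thesis by (simp add: prob_space)
  qed
  have EV: "expectation V = n * (2 * \<delta>)"
    unfolding V_def using integrable_E[OF _ integrable_abs[OF hi]] int_E[of _ "\<lambda>x. \<bar>h x\<bar>"] hm
    by (simp add: Bochner_Integration.integral_sum prob_space \<delta>_def)
  have b\<delta>: "\<bar>b\<bar> \<le> \<delta>"
    unfolding b_def \<delta>_def by (rule integral_abs_bound)
  have "\<bar>(\<Sum>i<n. g (E i \<omega>) + h (E i \<omega>)) / n - (a + b)\<bar> \<le> (\<bar>U \<omega>\<bar> + V \<omega>) / n" for \<omega>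
  proof -
    have "(\<Sum>i<n. g (E i \<omega>) + h (E i \<omega>)) / n - (a + b) = (U \<omega> + (\<Sum>i<n. h (E i \<omega>) - b)) / n"
      using n by (simp add: U_def X_def sum.distrib sum_subtractf field_simps)
    moreover have "\<bar>\<Sum>i<n. h (E i \<omega>) - b\<bar> \<le> V \<omega>"
      unfolding V_def using b\<delta> by (intro order_trans[OF sum_abs] sum_mono) linarith
    ultimately show ?thesis
      using n by (auto intro!: divide_right_mono)
  qed
  moreover have "(\<integral>x. g x + h x \<partial>\<mu>) = a + b"
    using gi hi by (simp add: a_def b_def)
  ultimately have "{\<omega> \<in> space M. dist ((\<Sum>i<n. g (E i \<omega>) + h (E i \<omega>)) / n) (\<integral>x. g x + h x \<partial>\<mu>) > \<epsilon>}
      \<subseteq> {\<omega> \<in> space M. \<bar>U \<omega>\<bar> + V \<omega> > n * \<epsilon>}"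
    using n by (auto simp: dist_real_def field_simps) (smt (verit, best))
  \<comment> \<open>If the sum of two terms exceeds \<open>n *\<close>\<epsilon>, one of them is at
    least half of it. Chebyshev's inequality bounds the event for \<open>U\<close>, Markov's
    inequality the one for \<open>V\<close>.\<close>
  also have "\<dots> \<subseteq> {\<omega> \<in> space M. \<bar>U \<omega>\<bar> \<ge> n * \<epsilon> / 2} \<union> {\<omega> \<in> space M. V \<omega> \<ge> n * \<epsilon> / 2}"
    by auto
  finally have "prob {\<omega> \<in> space M. dist ((\<Sum>i<n. g (E i \<omega>) + h (E i \<omega>)) / n) (\<integral>x. g x + h x \<partial>\<mu>) > \<epsilon>}
      \<le> prob ({\<omega> \<in> space M. \<bar>U \<omega>\<bar> \<ge> n * \<epsilon> / 2} \<union> {\<omega> \<in> space M. V \<omega> \<ge> n * \<epsilon> / 2})"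
    by (rule finite_measure_mono) measurable
  also have "\<dots> \<le> prob {\<omega> \<in> space M. \<bar>U \<omega>\<bar> \<ge> n * \<epsilon> / 2} + prob {\<omega> \<in> space M. V \<omega> \<ge> n * \<epsilon> / 2}"
    by (intro measure_Un_le) measurable
  also have "prob {\<omega> \<in> space M. \<bar>U \<omega>\<bar> \<ge> n * \<epsilon> / 2} \<le> expectation (\<lambda>\<omega>. (U \<omega>)\<^sup>2) / (n * \<epsilon> / 2)\<^sup>2"
    using n \<epsilon> unfolding U_def by (intro second_moment_method integrable_square_sum Xsq uncorr) auto
  also have "\<dots> \<le> n * (4 * K\<^sup>2) / (n * \<epsilon> / 2)\<^sup>2"
    by (intro divide_right_mono U2) simp
  also have "\<dots> = 16 * K\<^sup>2 / (n * \<epsilon>\<^sup>2)"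
    using n \<epsilon> by (simp add: field_simps power2_eq_square)
  also have "prob {\<omega> \<in> space M. V \<omega> \<ge> n * \<epsilon> / 2} \<le> expectation V / (n * \<epsilon> / 2)"
    using n \<epsilon> by (intro integral_Markov_inequality_measure[where A = "space M"] Vi)
      (auto simp: V_def \<delta>_def intro!: sum_nonneg add_nonneg_nonneg)
  also have "\<dots> = 4 * \<delta> / \<epsilon>"
    using n \<epsilon> by (simp add: EV field_simps)
  finally show ?thesis
    by (simp add: \<delta>_def)
qed

text \<open>Stated for an array: every sample size has its own errors, and nothing links different
  sample sizes except the common law \<mu>. Only integrability of \<open>f\<close> is assumed, since
  here \<open>f\<close> is a product of two error coordinates, for which no second moment is
  available.\<close>

lemma (in prob_space) weak_law_of_large_numbers:
  fixes E :: "nat \<Rightarrow> 'a \<Rightarrow> nat \<Rightarrow> 'b" and f :: "'b \<Rightarrow> real"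
  assumes indep: "\<And>n. n > m \<Longrightarrow> indep_vars (\<lambda>_. N) (\<lambda>i \<omega>. E n \<omega> i) {..<n}"
    and distr: "\<And>n i. n > m \<Longrightarrow> i < n \<Longrightarrow> distr M N (\<lambda>\<omega>. E n \<omega> i) = \<mu>"
    and f: "integrable \<mu> f"
  shows "converges_in_probability M (\<lambda>n \<omega>. (\<Sum>i<n. f (E n \<omega> i)) / n) (\<integral>x. f x \<partial>\<mu>)"
  unfolding converges_in_probability_def
proof (intro conjI allI impI)
  have Em: "(\<lambda>\<omega>. E n \<omega> i) \<in> measurable M N" if "n > m" "i < n" for n i
    using indep[OF that(1)] that(2) by (auto simp: indep_vars_def)
  have sets_\<mu>: "sets \<mu> = sets N"
    using distr[of "Suc m" 0] by auto
  have fm [measurable]: "f \<in> borel_measurable N"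
    using borel_measurable_integrable[OF f] by (simp add: measurable_cong_sets[OF sets_\<mu> refl])
  show "\<forall>\<^sub>F n in sequentially. (\<lambda>\<omega>. (\<Sum>i<n. f (E n \<omega> i)) / n) \<in> borel_measurable M"
    using eventually_gt_at_top[of m]
    by eventually_elim
      (intro borel_measurable_divide borel_measurable_sum borel_measurable_const
        measurable_compose[OF Em fm], auto)
  fix \<epsilon> :: real assume \<epsilon>: "\<epsilon> > 0"
  \<comment> \<open>Truncation at level \<open>K\<close>: \<open>g K\<close> is bounded, and the
    mean absolute value of \<open>h K\<close> tends to 0 by dominated convergence as
    \<open>K\<close> grows.\<close>
  define g where "g K x = (if \<bar>f x\<bar> \<le> real K then f x else 0)" for K x
  define h where "h K x = (if \<bar>f x\<bar> \<le> real K then 0 else f x)" for K x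
  have gm: "g K \<in> borel_measurable N" and hm: "h K \<in> borel_measurable N" for K
    unfolding g_def h_def by measurable
  have gK: "\<bar>g K x\<bar> \<le> real K" for K x
    by (simp add: g_def)
  have hm': "h K \<in> borel_measurable \<mu>" for K
    using hm by (simp add: measurable_cong_sets[OF sets_\<mu> refl])
  have hi: "integrable \<mu> (h K)" for K
    using f hm' by (rule Bochner_Integration.integrable_bound) (auto simp: h_def)
  have gh: "g K x + h K x = f x" for K x
    by (simp add: g_def h_def)
  have "(\<lambda>K. \<integral>x. \<bar>h K x\<bar> \<partial>\<mu>) \<longlonglongrightarrow> (\<integral>x. 0 \<partial>\<mu>)"
  proof (rule integral_dominated_convergence[where w = "\<lambda>x. \<bar>f x\<bar>"])
    show "AE x in \<mu>. (\<lambda>K. \<bar>h K x\<bar>) \<longlonglongrightarrow> 0"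
    proof (rule AE_I2)
      fix x
      obtain K0 :: nat where "\<bar>f x\<bar> \<le> real K0"
        using real_arch_simple by blast
      then have "\<forall>\<^sub>F K in sequentially. \<bar>h K x\<bar> = 0"
        by (intro eventually_mono[OF eventually_ge_at_top[of K0]]) (auto simp: h_def)
      then show "(\<lambda>K. \<bar>h K x\<bar>) \<longlonglongrightarrow> 0"
        by (rule tendsto_eventually)
    qed
  qed (use f hm' in \<open>auto simp: h_def\<close>)
  then have h0: "(\<lambda>K. 4 * (\<integral>x. \<bar>h K x\<bar> \<partial>\<mu>) / \<epsilon>) \<longlonglongrightarrow> 0"
    by (intro tendsto_divide_zero tendsto_mult_right_zero) simp
  show "(\<lambda>n. prob {\<omega> \<in> space M. dist ((\<Sum>i<n. f (E n \<omega> i)) / n) (\<integral>x. f x \<partial>\<mu>) > \<epsilon>}) \<longlonglongrightarrow> 0"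
    (is "?p \<longlonglongrightarrow> 0")
  proof (rule order_tendstoI)
    fix \<eta> :: real assume \<eta>: "0 < \<eta>"
    \<comment> \<open>The level is fixed first: the remainder bound does not depend on
      \<open>n\<close>, so \<open>n\<close> can grow afterwards to make the Chebyshev term
      small.\<close>
    then obtain K where K: "4 * (\<integral>x. \<bar>h K x\<bar> \<partial>\<mu>) / \<epsilon> < \<eta> / 2"
      using order_tendstoD(2)[OF h0, of "\<eta> / 2"] by (auto simp: eventually_sequentially)
    have "(\<lambda>n. (16 * (real K)\<^sup>2 / \<epsilon>\<^sup>2) / real n) \<longlonglongrightarrow> 0"
      by (rule lim_const_over_n)
    then have "\<forall>\<^sub>F n in sequentially. (16 * (real K)\<^sup>2 / \<epsilon>\<^sup>2) / real n < \<eta> / 2"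
      using \<eta> by (intro order_tendstoD) auto
    then show "\<forall>\<^sub>F n in sequentially. ?p n < \<eta>"
      using eventually_gt_at_top[of m]
    proof eventually_elim
      case (elim n)
      have "?p n \<le> 16 * (real K)\<^sup>2 / (n * \<epsilon>\<^sup>2) + 4 * (\<integral>x. \<bar>h K x\<bar> \<partial>\<mu>) / \<epsilon>"
        using sample_mean_deviation[where n = n and E = "\<lambda>i \<omega>. E n \<omega> i" and g = "g K" and h = "h K" and K = "real K",
            OF _ \<epsilon> indep distr gm gK hm hi] elim
        by (simp add: gh)
      also have "16 * (real K)\<^sup>2 / (n * \<epsilon>\<^sup>2) = (16 * (real K)\<^sup>2 / \<epsilon>\<^sup>2) / real n"
        by simp
      finally show ?case
        using elim(1) K by simp
    qed
  qed (auto intro!: always_eventually intro: less_le_trans[OF _ measure_nonneg])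
qed

subsection \<open>Consistency\<close>

text \<open>With \<open>Q n = L n / n\<close>, which tends to the invertible \<open>R\<close>, the
  inverse of \<open>L n\<close> is that of \<open>Q n\<close> divided by \<open>n\<close>: a
  convergent sequence times one that tends to 0.\<close>

lemma scaled_tendsto_invertible:
  fixes L :: "nat \<Rightarrow> real ^ 'm ^ 'm"
  assumes lim: "(\<lambda>n. (1 / real n) *\<^sub>R L n) \<longlonglongrightarrow> R" and R: "invertible R"
  shows "\<forall>\<^sub>F n in sequentially. invertible (L n)"
    and "(\<lambda>n. matrix_inv (L n)) \<longlonglongrightarrow> 0"
proof -
  define Q where "Q n = (1 / real n) *\<^sub>R L n" for n
  have Q: "Q \<longlonglongrightarrow> R"
    using lim by (simp add: Q_def[abs_def])
  have "\<forall>\<^sub>F n in sequentially. det (Q n) \<noteq> 0"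
    using tendsto_det[OF Q] R invertible_det_nz by (intro tendsto_imp_eventually_ne) auto
  then have inv: "\<forall>\<^sub>F n in sequentially. L n ** ((1 / real n) *\<^sub>R matrix_inv (Q n)) = mat 1"
    using eventually_gt_at_top[of 0]
    by eventually_elim
      (simp add: matrix_scalar_ac Q_def[symmetric] matrix_inv_right invertible_det_nz)
  then show "\<forall>\<^sub>F n in sequentially. invertible (L n)"
    by eventually_elim (use invertible_right_inverse in blast)
  have "(\<lambda>n. (1 / real n) *\<^sub>R matrix_inv (Q n)) \<longlonglongrightarrow> 0 *\<^sub>R matrix_inv R"
    by (intro tendsto_intros Q R lim_1_over_n)
  moreover have "\<forall>\<^sub>F n in sequentially. (1 / real n) *\<^sub>R matrix_inv (Q n) = matrix_inv (L n)"
    using inv by eventually_elim (simp add: matrix_inv_unique)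
  ultimately show "(\<lambda>n. matrix_inv (L n)) \<longlonglongrightarrow> 0"
    using Lim_transform_eventually by fastforce
qed

lemma matrix_mult_tmult_component:
  "(V ** tmult n X E) $ a $ b = (\<Sum>i<n. (V *v X i) $ a * E i $ b)"
proof -
  have "(V ** tmult n X E) $ a $ b = (\<Sum>c\<in>UNIV. \<Sum>i<n. V $ a $ c * X i $ c * E i $ b)"
    by (simp add: matrix_matrix_mult_def tmult_def sum_distrib_left mult.assoc)
  also have "\<dots> = (\<Sum>i<n. \<Sum>c\<in>UNIV. V $ a $ c * X i $ c * E i $ b)"
    by (rule sum.swap)
  finally show ?thesis
    by (simp add: matrix_vector_mult_def sum_distrib_right)
qed

text \<open>The left-hand side is the diagonal entry of \<open>V (X'X) V'\<close>, which equals
  \<open>V'\<close> because \<open>V\<close> inverts \<open>X'X\<close>. It turns the variance of an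
  entry of \<open>G\<close> into an entry of the inverse of \<open>X'X\<close>.\<close>

lemma sum_least_squares_weights:
  assumes "invertible (tmult n X X)"
  defines "V \<equiv> matrix_inv (tmult n X X)"
  shows "(\<Sum>i<n. ((V *v X i) $ a)\<^sup>2) = V $ a $ a"
proof -
  have "(V ** tmult n X X ** transpose V) $ a $ a
      = (\<Sum>c\<in>UNIV. \<Sum>i<n. (V *v X i) $ a * (V $ a $ c * X i $ c))"
    by (subst matrix_matrix_mult_def)
      (simp add: matrix_mult_tmult_component transpose_def sum_distrib_right mult.assoc
        mult.commute[of "X _ $ _"])
  also have "\<dots> = (\<Sum>i<n. \<Sum>c\<in>UNIV. (V *v X i) $ a * (V $ a $ c * X i $ c))"
    by (rule sum.swap)
  also have "\<dots> = (\<Sum>i<n. (V *v X i) $ a * (V *v X i) $ a)"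
    by (simp only: sum_distrib_left[symmetric]) (simp add: matrix_vector_mult_def)
  finally show ?thesis
    using assms by (simp add: matrix_inv_left power2_eq_square transpose_def)
qed

lemma linear_model_estimates:
  fixes X :: "nat \<Rightarrow> real ^ 'm" and B :: "real ^ 'p ^ 'm"
  assumes L: "invertible (tmult n X X)"
    and Y: "\<And>i. i < n \<Longrightarrow> Y i = X i v* B + E i"
  defines "G \<equiv> matrix_inv (tmult n X X) ** tmult n X E"
  shows "matrix_inv (tmult n X X) ** tmult n X Y = B + G"
    and "Sigma_hat n X Y = (1 / (real n - real (rows_rank n X))) *\<^sub>R
      (tmult n E E - transpose G ** tmult n X X ** G)"
proof -
  \<comment> \<open>\<open>W\<close> stays arbitrary because the formula is used with
    \<open>X\<close>, \<open>E\<close> and \<open>Y\<close> in its place.\<close>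
  have YX: "tmult n Y W = transpose B ** tmult n X W + tmult n E W" for W :: "'c::finite rows"
    using Y by (subst tmult_cong[where A' = "\<lambda>i. X i v* B + E i" and B' = W]) (auto simp: tmult_add_left)
  have XY: "tmult n X Y = tmult n X X ** B + tmult n X E"
    using arg_cong[OF YX[of X], of transpose]
    by (simp add: transpose_tmult matrix_transpose_mul transpose_add)
  have EY: "tmult n E Y = transpose (tmult n X E) ** B + tmult n E E"
    using arg_cong[OF YX[of E], of transpose]
    by (simp add: transpose_tmult matrix_transpose_mul transpose_add)
  show "matrix_inv (tmult n X X) ** tmult n X Y = B + G"
    by (simp add: XY G_def matrix_add_ldistrib matrix_mul_assoc matrix_inv_left L)
  have "tmult n Y Y = transpose B ** (tmult n X X ** B + tmult n X E)
      + (transpose (tmult n X E) ** B + tmult n E E)"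
    using YX[of Y] by (simp add: XY EY)
  then show "Sigma_hat n X Y = (1 / (real n - real (rows_rank n X))) *\<^sub>R
      (tmult n E E - transpose G ** tmult n X X ** G)"
    using residual_cross_product[OF L transpose_tmult, of B "tmult n X E" "tmult n E E"]
    by (simp add: Sigma_hat_eq XY G_def)
qed

theorem theorem3p3:
  fixes M :: "'a measure"
    and X :: "nat \<Rightarrow> real ^ 'm"
    and Z :: "real ^ 'q ^ 'p"
    and \<Theta> :: "real ^ 'q ^ 'm"
    and \<Sigma> :: "real ^ 'p ^ 'p"
    and R :: "real ^ 'm ^ 'm"
    and C :: "real ^ 'm ^ 's"
    and D :: "real ^ 'q ^ 't"
    and \<mu> :: "(real ^ 'p) measure"
    and \<E> Y :: "nat \<Rightarrow> 'a \<Rightarrow> nat \<Rightarrow> real ^ 'p"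
  assumes "prob_space M"
    and "CARD('p) > CARD('q)"
    and "\<And>n. n > CARD('m) \<Longrightarrow> rows_rank n X = CARD('m)"
    and "rank Z = CARD('q)"
    and "pos_def \<Sigma>"
    and "\<And>n. n > CARD('m) \<Longrightarrow> prob_space.indep_vars M (\<lambda>_. borel) (\<lambda>i \<omega>. \<E> n \<omega> i) {..<n}"
    and "\<And>n i. n > CARD('m) \<Longrightarrow> i < n \<Longrightarrow> distr M borel (\<lambda>\<omega>. \<E> n \<omega> i) = \<mu>"
    and "\<And>n. n > CARD('m) \<Longrightarrow> continuous_distribution M n (\<E> n)"
    and "\<And>n i j. n > CARD('m) \<Longrightarrow> i < n \<Longrightarrow> integrable M (\<lambda>\<omega>. (\<E> n \<omega> i $ j)\<^sup>2)"
    and "\<And>n i j. n > CARD('m) \<Longrightarrow> i < n \<Longrightarrow> (\<integral>\<omega>. \<E> n \<omega> i $ j \<partial>M) = 0"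
    and "\<And>n i j k l. n > CARD('m) \<Longrightarrow> i < n \<Longrightarrow> k < n \<Longrightarrow>
           covariance M (\<lambda>\<omega>. \<E> n \<omega> i $ j) (\<lambda>\<omega>. \<E> n \<omega> k $ l)
             = (if i = k then 1 else 0) * \<Sigma> $ j $ l"
    and "\<And>n \<omega> i. n > CARD('m) \<Longrightarrow> \<omega> \<in> space M \<Longrightarrow> i < n \<Longrightarrow>
           Y n \<omega> i = X i v* (\<Theta> ** transpose Z) + \<E> n \<omega> i"
    and "\<forall>\<^sub>F n in sequentially. AE \<omega> in M. pos_def (Sigma_hat n X (Y n \<omega>))"
    and "(\<lambda>n. (1 / real n) *\<^sub>R tmult n X X) \<longlonglongrightarrow> R"
    and "pos_def R"
  shows "converges_in_probability M (\<lambda>n \<omega>. gamma_hat n X Z C D (Y n \<omega>)) (C ** \<Theta> ** transpose D)"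
proof -
  interpret prob_space M by fact
  note rank_X = assms(3) and rank_Z = assms(4) and pd = assms(5) and indep = assms(6)
    and distr = assms(7) and square_integrable = assms(9) and mean = assms(10) and cov = assms(11)
    and Y = assms(12) and lim = assms(14) and pd_R = assms(15)
  define L where "L n = tmult n X X" for n
  define A where "A n \<omega> = (1 / real n) *\<^sub>R tmult n (\<E> n \<omega>) (\<E> n \<omega>)" for n \<omega>
  define G where "G n \<omega> = matrix_inv (L n) ** tmult n X (\<E> n \<omega>)" for n \<omega>
  have large: "\<forall>\<^sub>F n in sequentially. n > CARD('m)"
    by (rule eventually_gt_at_top)
  have inv: "\<forall>\<^sub>F n in sequentially. invertible (L n)"
    and inv_lim: "(\<lambda>n. matrix_inv (L n)) \<longlonglongrightarrow> 0"
    using scaled_tendsto_invertible[OF lim pos_def_invertible[OF pd_R]] by (simp_all add: L_def)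

  have Em [measurable]: "(\<lambda>\<omega>. \<E> n \<omega> i) \<in> borel_measurable M" if "n > CARD('m)" "i < n" for n i
    using indep[OF that(1)] that(2) by (auto simp: indep_vars_def)
  have Ejm [measurable]: "(\<lambda>\<omega>. \<E> n \<omega> i $ j) \<in> borel_measurable M" if "n > CARD('m)" "i < n" for n i j
    using Em[OF that] by measurable
  \<comment> \<open>The errors have mean zero, so their covariances are plain mixed moments.\<close>
  have second_moment: "expectation (\<lambda>\<omega>. \<E> n \<omega> i $ j * \<E> n \<omega> k $ l) = (if i = k then 1 else 0) * \<Sigma> $ j $ l"
    if "n > CARD('m)" "i < n" "k < n" for n i j k l
    using cov[OF that, of j l] mean that by (simp add: covariance_def)
  have prod_integrable: "integrable M (\<lambda>\<omega>. \<E> n \<omega> i $ j * \<E> n \<omega> i $ l)"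
    if "n > CARD('m)" "i < n" for n i j l
    using that by (intro integrable_mult_of_squares Ejm square_integrable)

  have A_lim: "converges_in_probability M A \<Sigma>"
  proof (intro converges_in_probability_vec)
    fix k l
    define f where "f x = x $ k * x $ l" for x :: "real ^ 'p"
    have fm [measurable]: "f \<in> borel_measurable borel"
      unfolding f_def by measurable
    \<comment> \<open>The moments of \<mu> are read off from error row 0 at the smallest admissible
      sample size.\<close>
    let ?n = "Suc CARD('m)"
    have \<mu>: "\<mu> = distr M borel (\<lambda>\<omega>. \<E> ?n \<omega> 0)"
      using distr[of ?n 0] by simp
    have "integrable \<mu> f"
      unfolding \<mu> using prod_integrable[of ?n 0 k l] Em[of ?n 0]
      by (subst integrable_distr_eq) (auto simp: f_def)
    then have "converges_in_probability M (\<lambda>n \<omega>. (\<Sum>i<n. f (\<E> n \<omega> i)) / n) (\<integral>x. f x \<partial>\<mu>)"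
      by (intro weak_law_of_large_numbers[where m = "CARD('m)" and N = borel]) (auto intro: indep distr)
    moreover have "(\<integral>x. f x \<partial>\<mu>) = \<Sigma> $ k $ l"
      unfolding \<mu> using second_moment[of ?n 0 0 k l] Em[of ?n 0]
      by (subst integral_distr) (auto simp: f_def)
    ultimately show "converges_in_probability M (\<lambda>n \<omega>. A n \<omega> $ k $ l) (\<Sigma> $ k $ l)"
      by (simp add: A_def tmult_def f_def)
  qed

  have G_lim: "converges_in_probability M G 0"
  proof (intro converges_in_probability_vec)
    fix a b
    \<comment> \<open>Each entry of \<open>G\<close> is a sum of errors with these deterministic
      weights.\<close>
    define w where "w n i = (matrix_inv (L n) *v X i) $ a" for n i
    have G_eq: "G n \<omega> $ a $ b = (\<Sum>i<n. w n i * \<E> n \<omega> i $ b)" for n \<omega>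
      by (simp add: G_def matrix_mult_tmult_component w_def)
    have wm: "(\<lambda>\<omega>. w n i * \<E> n \<omega> i $ b) \<in> borel_measurable M" if "n > CARD('m)" "i \<in> {..<n}" for n i
      using that by (intro borel_measurable_times Ejm) auto
    have wsq: "integrable M (\<lambda>\<omega>. (w n i * \<E> n \<omega> i $ b)\<^sup>2)" if "n > CARD('m)" "i \<in> {..<n}" for n i
      using that square_integrable[of n i b] by (simp add: power_mult_distrib)
    \<comment> \<open>The case \<open>i = j\<close> is included: it supplies the variances, the
      other cases the vanishing cross terms.\<close>
    have uncorr: "expectation (\<lambda>\<omega>. (w n i * \<E> n \<omega> i $ b) * (w n j * \<E> n \<omega> j $ b))
        = w n i * w n j * ((if i = j then 1 else 0) * \<Sigma> $ b $ b)"
      if "n > CARD('m)" "i \<in> {..<n}" "j \<in> {..<n}" for n i j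
      using second_moment[of n i j b b] that
      by (simp add: mult.assoc mult.left_commute[of _ "w n j"] del: mult_cancel_left)
    have "converges_in_probability M (\<lambda>n \<omega>. G n \<omega> $ a $ b) 0"
    proof (rule converges_in_probability_second_moment)
      show "\<forall>\<^sub>F n in sequentially. (\<lambda>\<omega>. G n \<omega> $ a $ b) \<in> borel_measurable M"
        unfolding G_eq using large by eventually_elim (intro borel_measurable_sum wm)
      show "\<forall>\<^sub>F n in sequentially. integrable M (\<lambda>\<omega>. (G n \<omega> $ a $ b)\<^sup>2)"
        unfolding G_eq using large
        by eventually_elim (intro integrable_square_sum wm wsq, auto simp: uncorr)
      have "(\<lambda>n. matrix_inv (L n) $ a $ a * \<Sigma> $ b $ b) \<longlonglongrightarrow> 0 $ a $ a * \<Sigma> $ b $ b"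
        by (intro tendsto_intros inv_lim)
      moreover have "\<forall>\<^sub>F n in sequentially. matrix_inv (L n) $ a $ a * \<Sigma> $ b $ b
          = expectation (\<lambda>\<omega>. (G n \<omega> $ a $ b)\<^sup>2)"
        using large inv
      proof eventually_elim
        case (elim n)
        have "expectation (\<lambda>\<omega>. (G n \<omega> $ a $ b)\<^sup>2) = (\<Sum>i<n. expectation (\<lambda>\<omega>. (w n i * \<E> n \<omega> i $ b)\<^sup>2))"
          unfolding G_eq using elim(1)
          by (intro expectation_square_sum_uncorrelated wm wsq) (auto simp: uncorr)
        also have "\<dots> = (\<Sum>i<n. (w n i)\<^sup>2 * \<Sigma> $ b $ b)"
          using uncorr[OF elim(1)] by (intro sum.cong refl) (simp add: power2_eq_square)
        also have "\<dots> = matrix_inv (L n) $ a $ a * \<Sigma> $ b $ b"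
          using sum_least_squares_weights[of n X a] elim(2)
          by (simp add: w_def L_def flip: sum_distrib_right)
        finally show ?case by simp
      qed
      ultimately show "(\<lambda>n. expectation (\<lambda>\<omega>. (G n \<omega> $ a $ b)\<^sup>2)) \<longlonglongrightarrow> 0"
        using Lim_transform_eventually by fastforce
    qed
    then show "converges_in_probability M (\<lambda>n \<omega>. G n \<omega> $ a $ b) (0 $ a $ b)"
      by simp
  qed

  \<comment> \<open>The argument \<open>p\<close> stands for
    \<open>(A, G, X'X / n, n / (n - m))\<close>. At this point \<open>S\<close> is the inverse of
    the first-stage covariance estimator, and \<open>F\<close> is the estimator of \<gamma>.\<close>
  define S where "S p = matrix_inv (snd (snd (snd p)) *\<^sub>R
      (fst p - transpose (fst (snd p)) ** fst (snd (snd p)) ** fst (snd p)))"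
    for p :: "(real ^ 'p ^ 'p) \<times> (real ^ 'p ^ 'm) \<times> (real ^ 'm ^ 'm) \<times> real"
  define F where "F p = C ** (\<Theta> ** transpose Z + fst (snd p)) ** S p ** Z
      ** matrix_inv (transpose Z ** S p ** Z) ** transpose D" for p
  define c where "c = (\<Sigma>, 0 :: real ^ 'p ^ 'm, R, 1 :: real)"

  have ratio: "(\<lambda>n. real n / (real n - real CARD('m))) \<longlonglongrightarrow> 1"
    by real_asymp
  have joint_lim: "converges_in_probability M
      (\<lambda>n \<omega>. (A n \<omega>, G n \<omega>, (1 / real n) *\<^sub>R L n, real n / (real n - real CARD('m)))) c"
    unfolding c_def L_def
    by (intro converges_in_probability_Pair A_lim G_lim converges_in_probability_const lim ratio)

  have zero: "transpose 0 ** Q ** 0 = (0 :: real ^ 'p ^ 'p)" for Q :: "real ^ 'm ^ 'm"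
    by (simp add: matrix_matrix_mult_def vec_eq_iff)
  have S_c: "S c = matrix_inv \<Sigma>"
    by (simp add: S_def c_def zero)
  have inv_c: "invertible (transpose Z ** S c ** Z)"
    unfolding S_c by (rule invertible_congruence_matrix_inv[OF pd rank_Z])
  \<comment> \<open>Inversion is continuous at invertible matrices. At \<open>c\<close> the
    correction term vanishes with \<open>G\<close>, leaving the invertible \<Sigma>.\<close>
  have "(S \<longlongrightarrow> S c) (at c)"
    unfolding S_def by (intro tendsto_intros) (simp add: c_def zero pos_def_invertible pd)
  then have "isCont F c"
    unfolding isCont_def F_def by (intro tendsto_intros inv_c)
  moreover have "F \<in> borel_measurable borel"
  proof -
    note [measurable (raw)] = borel_measurable_fst borel_measurable_snd
    have [measurable]: "S \<in> borel_measurable borel"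
      unfolding S_def by measurable
    show ?thesis
      unfolding F_def by measurable
  qed
  ultimately have "converges_in_probability M
      (\<lambda>n \<omega>. F (A n \<omega>, G n \<omega>, (1 / real n) *\<^sub>R L n, real n / (real n - real CARD('m)))) (F c)"
    by (rule converges_in_probability_continuous_map[OF joint_lim])
  moreover have "F c = C ** \<Theta> ** transpose D"
  proof -
    \<comment> \<open>At \<open>c\<close> the factor \<open>Z'\<close> of the mean meets
      \<open>S c ** Z\<close> and cancels against the inverse that follows.\<close>
    have "F c = C ** \<Theta> ** (transpose Z ** S c ** Z ** matrix_inv (transpose Z ** S c ** Z)) ** transpose D"
      by (simp add: F_def c_def matrix_mul_assoc)
    then show ?thesis
      by (simp add: matrix_inv_right[OF inv_c])
  qed
  moreover have "\<forall>\<^sub>F n in sequentially. \<forall>\<omega>\<in>space M.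
      F (A n \<omega>, G n \<omega>, (1 / real n) *\<^sub>R L n, real n / (real n - real CARD('m)))
      = gamma_hat n X Z C D (Y n \<omega>)"
    using large inv
  proof eventually_elim
    case (elim n)
    show ?case
    proof
      fix \<omega> assume \<omega>: "\<omega> \<in> space M"
      have est: "matrix_inv (L n) ** tmult n X (Y n \<omega>) = \<Theta> ** transpose Z + G n \<omega>"
        "Sigma_hat n X (Y n \<omega>) = (1 / (real n - real CARD('m))) *\<^sub>R
          (tmult n (\<E> n \<omega>) (\<E> n \<omega>) - transpose (G n \<omega>) ** L n ** G n \<omega>)"
        unfolding L_def G_def rank_X[OF elim(1), symmetric]
        using elim(2) Y[OF elim(1) \<omega>] by (intro linear_model_estimates; simp add: L_def)+
      have "S (A n \<omega>, G n \<omega>, (1 / real n) *\<^sub>R L n, real n / (real n - real CARD('m)))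
          = matrix_inv (Sigma_hat n X (Y n \<omega>))"
        \<comment> \<open>\<open>n / (n - m)\<close> times the factor \<open>1 / n\<close> in both
          \<open>A\<close> and \<open>X'X / n\<close> is \<open>1 / (n - m)\<close>; this uses
          \<open>n > 0\<close>.\<close>
        using elim(1) unfolding est(2)
        by (simp add: S_def A_def matrix_scalar_ac scaleR_diff_right
            flip: scalar_matrix_assoc)
      moreover have "C ** matrix_inv (L n) ** tmult n X (Y n \<omega>) = C ** (\<Theta> ** transpose Z + G n \<omega>)"
        using est(1) by (simp flip: matrix_mul_assoc)
      ultimately show "F (A n \<omega>, G n \<omega>, (1 / real n) *\<^sub>R L n, real n / (real n - real CARD('m)))
          = gamma_hat n X Z C D (Y n \<omega>)"
        by (simp add: F_def gamma_hat_def L_def Let_def)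
    qed
  qed
  ultimately show ?thesis
    using converges_in_probability_cong by fastforce
qed

end
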